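(* Let $\mathcal{G}=(\mathcal{V},\mathcal{E})$ be a finite graph, let $\mathcal{S}'$ be the current subset of its maximal independent sets, let $\hat{\bm{y}}\in\mathbb{R}^{\mathcal{V}}$, and let $\epsilon_{\mathrm{cur}}\ge 0$ be the current penalty parameter. Let $\bm{\pi}^{\epsilon}$ be (the $\bm{\pi}$-part of) an optimal solution of G-RDP$(\mathcal{S}',\hat{\bm{y}},\epsilon_{\mathrm{cur}})$, let $c^*_{\epsilon}=c^*(\bm{\pi}^{\epsilon})$ be the minimum reduced cost with respect to $\bm{\pi}^{\epsilon}$, and let $\bm{\pi}$ be an optimal solution of the standard restricted dual problem RDP$(\mathcal{S}')$. Define the Lagrangian gap $$l = 1-\frac{L(\bm{\pi}^{\epsilon})}{z(\bm{\pi})},\qquad L(\bm{\pi}^{\epsilon})=\frac{z(\bm{\pi}^{\epsilon})}{1-c^*_{\epsilon}},$$ and define the (updated) penalty value $$\epsilon=\begin{cases}\dfrac{c^*_{\epsilon}}{c^*_{\epsilon}-1}, & \text{if } c^*_{\epsilon}<0,\\[2mm] 0, & \text{if } c^*_{\epsilon}\ge 0.\end{cases}$$ Then $0\le \epsilon\le l$.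
   Context: Let $\mathcal{S}$ be the set of all maximal independent sets (MISs) of the finite graph $\mathcal{G}=(\mathcal{V},\mathcal{E})$ ($\mathcal{V}$ non-empty), each MIS being regarded as a subset $s\subseteq\mathcal{V}$. Objective: $z(\bm{\pi})=\sum_{i\in\mathcal{V}}\pi_i$ for $\bm{\pi}\in\mathbb{R}^{\mathcal{V}}$. Restricted dual problem RDP$(\mathcal{S}')$, for $\mathcal{S}'\subseteq\mathcal{S}$: maximize $z(\bm{\pi})$ subject to $\sum_{i\in s}\pi_i\le 1$ for all $s\in\mathcal{S}'$ and $0\le\pi_i\le 1$ for all $i\in\mathcal{V}$. (The full dual problem is the case $\mathcal{S}'=\mathcal{S}$.) Generalized restricted dual problem G-RDP$(\mathcal{S}',\hat{\bm{y}},\epsilon)$, for a given (predicted) vector $\hat{\bm{y}}\in\mathbb{R}^{\mathcal{V}}$ and penalty parameter $\epsilon\ge 0$: maximize $\sum_{i\in\mathcal{V}}(\pi_i-\epsilon w_i^- -\epsilon w_i^+)$ over $(\bm{\pi},\bm{w}^+,\bm{w}^-)$ subject to $\sum_{i\in s}\pi_i\le 1$ for all $s\in\mathcal{S}'$; $-\pi_i-w_i^-\le-\hat{y}_i$ and $\pi_i-w_i^+\le\hat{y}_i$ for all $i\in\mathcal{V}$; and $0\le\pi_i,w_i^-,w_i^+\le 1$ for all $i\in\mathcal{V}$. The vector $\hat{\bm{y}}$ is such that this problem is feasible (e.g. $\hat{\bm{y}}\in[0,1]^{\mathcal{V}}$). Pricing and minimum reduced cost: for $\bm{\pi}\in[0,1]^{\mathcal{V}}$,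 $c^*(\bm{\pi})=\min_{s\in\mathcal{S}}\bigl(1-\sum_{i\in s}\pi_i\bigr)$; equivalently, the minimum of $1-\sum_{i\in\mathcal{V}}\pi_i v_i$ over $\bm{v}\in\{0,1\}^{\mathcal{V}}$ with $v_i+v_j\le 1$ for all $(i,j)\in\mathcal{E}$. The quantity $L(\bm{\pi}^{\epsilon})$ is understood to be defined, i.e. $c^*_{\epsilon}\neq 1$ (equivalently $\bm{\pi}^{\epsilon}\ne 0$). *)

theory Defs
  imports Complex_Main "HOL-Library.Ramsey"
begin

text \<open>A finite simple graph with vertex set \<open>V\<close> and a set \<open>E\<close> of two-element subsets
  of \<open>V\<close>. Vectors indexed by \<open>V\<close> are functions \<open>'a \<Rightarrow> real\<close>; all notions below look at
  their values on \<open>V\<close> only.\<close>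

definition simple_graph :: "'a set \<Rightarrow> 'a set set \<Rightarrow> bool" where
  "simple_graph V E \<longleftrightarrow> finite V \<and> V \<noteq> {} \<and> E \<subseteq> nsets V 2"

definition max_indep_sets :: "'a set \<Rightarrow> 'a set set \<Rightarrow> 'a set set" where
  "max_indep_sets V E =
     {s. s \<subseteq> V \<and> indep s E \<and> (\<forall>t. t \<subseteq> V \<and> indep t E \<and> s \<subseteq> t \<longrightarrow> t = s)}"

definition dual_obj :: "'a set \<Rightarrow> ('a \<Rightarrow> real) \<Rightarrow> real" where
  "dual_obj V p = (\<Sum>i\<in>V. p i)"

definition rdp_feasible :: "'a set \<Rightarrow> 'a set set \<Rightarrow> ('a \<Rightarrow> real) \<Rightarrow> bool" where
  "rdp_feasible V S' p \<longleftrightarrow>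
     (\<forall>s\<in>S'. (\<Sum>i\<in>s. p i) \<le> 1) \<and> (\<forall>i\<in>V. 0 \<le> p i \<and> p i \<le> 1)"

definition rdp_optimal :: "'a set \<Rightarrow> 'a set set \<Rightarrow> ('a \<Rightarrow> real) \<Rightarrow> bool" where
  "rdp_optimal V S' p \<longleftrightarrow> is_arg_max (dual_obj V) (rdp_feasible V S') p"

text \<open>Solutions of the generalized problem are triples \<open>(p, wp, wm)\<close>, where \<open>wp\<close> and \<open>wm\<close>
  are the positive and negative deviations from the prediction \<open>y\<close>.\<close>

definition grdp_obj ::
  "'a set \<Rightarrow> real \<Rightarrow> ('a \<Rightarrow> real) \<times> ('a \<Rightarrow> real) \<times> ('a \<Rightarrow> real) \<Rightarrow> real" where
  "grdp_obj V eps = (\<lambda>(p, wp, wm). \<Sum>i\<in>V. p i - eps * wm i - eps * wp i)"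

definition grdp_feasible ::
  "'a set \<Rightarrow> 'a set set \<Rightarrow> ('a \<Rightarrow> real) \<Rightarrow>
     ('a \<Rightarrow> real) \<times> ('a \<Rightarrow> real) \<times> ('a \<Rightarrow> real) \<Rightarrow> bool" where
  "grdp_feasible V S' y = (\<lambda>(p, wp, wm).
     (\<forall>s\<in>S'. (\<Sum>i\<in>s. p i) \<le> 1) \<and>
     (\<forall>i\<in>V. - p i - wm i \<le> - y i \<and> p i - wp i \<le> y i) \<and>
     (\<forall>i\<in>V. 0 \<le> p i \<and> p i \<le> 1 \<and> 0 \<le> wm i \<and> wm i \<le> 1 \<and> 0 \<le> wp i \<and> wp i \<le> 1))"

definition grdp_optimal ::
  "'a set \<Rightarrow> 'a set set \<Rightarrow> ('a \<Rightarrow> real) \<Rightarrow> real \<Rightarrow>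
     ('a \<Rightarrow> real) \<times> ('a \<Rightarrow> real) \<times> ('a \<Rightarrow> real) \<Rightarrow> bool" where
  "grdp_optimal V S' y eps x \<longleftrightarrow> is_arg_max (grdp_obj V eps) (grdp_feasible V S' y) x"

definition min_reduced_cost :: "'a set \<Rightarrow> 'a set set \<Rightarrow> ('a \<Rightarrow> real) \<Rightarrow> real" where
  "min_reduced_cost V E p = Min ((\<lambda>s. 1 - (\<Sum>i\<in>s. p i)) ` max_indep_sets V E)"

text \<open>Meaningful only when \<open>min_reduced_cost V E p \<noteq> 1\<close>.\<close>

definition lagrangian_bound :: "'a set \<Rightarrow> 'a set set \<Rightarrow> ('a \<Rightarrow> real) \<Rightarrow> real" where
  "lagrangian_bound V E p = dual_obj V p / (1 - min_reduced_cost V E p)"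

definition lagrangian_gap ::
  "'a set \<Rightarrow> 'a set set \<Rightarrow> ('a \<Rightarrow> real) \<Rightarrow> ('a \<Rightarrow> real) \<Rightarrow> real" where
  "lagrangian_gap V E pe p = 1 - lagrangian_bound V E pe / dual_obj V p"

definition updated_penalty :: "real \<Rightarrow> real" where
  "updated_penalty c = (if c < 0 then c / (c - 1) else 0)"

end

(* The optimum pe of the generalized problem is feasible for the restricted dual problem, so
   z(pe) <= z(p); for c < 0 this is already the upper bound, since c / (c - 1) = 1 - 1 / (1 - c).
   For c >= 0 the vector pe / (1 - c) is feasible for the full dual problem, because every vertex
   lies in a maximal independent set; hence L(pe) <= z(p) and the gap is nonnegative. *)
theory Submission
  imports Defs
begin

lemma finite_max_indep_sets: "finite V \<Longrightarrow> finite (max_indep_sets V E)"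
  by (rule finite_subset[of _ "Pow V"]) (auto simp: max_indep_sets_def)

lemma indep_singleton:
  assumes "simple_graph V E"
  shows "indep {i} E"
  using assms by (auto simp: simple_graph_def indep_def nsets_def)

text \<open>The independent set \<open>{i}\<close> extends to a maximal member of the finite family
  of independent subsets of \<open>V\<close>.\<close>

lemma ex_max_indep_set_containing:
  assumes "simple_graph V E" "i \<in> V"
  obtains s where "s \<in> max_indep_sets V E" "i \<in> s"
proof -
  let ?A = "{t. t \<subseteq> V \<and> indep t E}"
  have fin: "finite ?A"
    using assms by (auto simp: simple_graph_def intro: finite_subset[of _ "Pow V"])
  have "{i} \<in> ?A"
    using assms by (simp add: indep_singleton)
  from finite_has_maximal2[OF fin this]
  obtain s where "s \<in> ?A" "{i} \<subseteq> s" "\<forall>t\<in>?A. s \<subseteq> t \<longrightarrow> s = t"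
    by (elim bexE conjE)
  then have "s \<in> max_indep_sets V E" "i \<in> s"
    by (auto simp: max_indep_sets_def)
  then show thesis by (rule that)
qed

lemma max_indep_sets_nonempty:
  assumes "simple_graph V E"
  shows "max_indep_sets V E \<noteq> {}"
proof -
  obtain i where "i \<in> V"
    using assms by (auto simp: simple_graph_def)
  with assms obtain s where "s \<in> max_indep_sets V E"
    by (rule ex_max_indep_set_containing)
  then show ?thesis by blast
qed

lemma sum_le_one_minus_min_reduced_cost:
  assumes "finite V" "s \<in> max_indep_sets V E"
  shows "(\<Sum>i\<in>s. p i) \<le> 1 - min_reduced_cost V E p"
proof -
  have "min_reduced_cost V E p \<le> 1 - (\<Sum>i\<in>s. p i)"
    unfolding min_reduced_cost_def
    using assms by (intro Min_le) (auto simp: finite_max_indep_sets)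
  then show ?thesis by simp
qed

text \<open>Nonnegative weights make every reduced cost at most 1, so excluding the value 1 makes
  the divisor \<open>1 - min_reduced_cost V E p\<close> strictly positive.\<close>

lemma min_reduced_cost_less_one:
  assumes "simple_graph V E" "\<forall>i\<in>V. 0 \<le> p i" "min_reduced_cost V E p \<noteq> 1"
  shows "min_reduced_cost V E p < 1"
proof -
  have fin: "finite V"
    using assms by (simp add: simple_graph_def)
  obtain s where s: "s \<in> max_indep_sets V E"
    using max_indep_sets_nonempty[OF assms(1)] by blast
  then have "0 \<le> (\<Sum>i\<in>s. p i)"
    using assms(2) by (intro sum_nonneg) (auto simp: max_indep_sets_def)
  with sum_le_one_minus_min_reduced_cost[OF fin s, of p] assms(3) show ?thesis by simp
qed

text \<open>A zero total of nonnegative weights would make every weight zero, and then every reduced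
  cost, hence their minimum, would be 1. This later justifies dividing by the optimal value.\<close>

lemma dual_obj_pos:
  assumes "simple_graph V E" "\<forall>i\<in>V. 0 \<le> p i" "min_reduced_cost V E p \<noteq> 1"
  shows "0 < dual_obj V p"
proof (rule ccontr)
  have fin: "finite V"
    using assms by (simp add: simple_graph_def)
  assume "\<not> 0 < dual_obj V p"
  moreover have "0 \<le> dual_obj V p"
    using assms(2) by (simp add: dual_obj_def sum_nonneg)
  ultimately have "dual_obj V p = 0"
    by linarith
  then have zero: "\<forall>i\<in>V. p i = 0"
    using assms(2) fin by (simp add: dual_obj_def sum_nonneg_eq_0_iff)
  have "1 - (\<Sum>i\<in>s. p i) = 1" if "s \<in> max_indep_sets V E" for s
    using that zero by (auto simp: max_indep_sets_def intro!: sum.neutral)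
  \<comment> \<open>Nonemptiness matters: it makes the image \<open>{1}\<close> rather than the
    empty set, on which \<open>Min\<close> is unspecified.\<close>
  then have "(\<lambda>s. 1 - (\<Sum>i\<in>s. p i)) ` max_indep_sets V E = {1}"
    using max_indep_sets_nonempty[OF assms(1)] by force
  with assms(3) show False
    by (simp add: min_reduced_cost_def)
qed

text \<open>The upper bounds on single coordinates come for free: each vertex lies in some maximal
  independent set, and by nonnegativity its weight is at most the sum over that set.\<close>

lemma rdp_feasible_max_indep_sets:
  assumes "simple_graph V E" "\<forall>i\<in>V. 0 \<le> p i"
    and "\<forall>s\<in>max_indep_sets V E. (\<Sum>i\<in>s. p i) \<le> 1"
  shows "rdp_feasible V (max_indep_sets V E) p"
proof -
  have "p i \<le> 1" if i: "i \<in> V" for i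
  proof -
    obtain s where s: "s \<in> max_indep_sets V E" "i \<in> s"
      using ex_max_indep_set_containing[OF assms(1) i] .
    then have "s \<subseteq> V" "finite s"
      using assms(1) by (auto simp: max_indep_sets_def simple_graph_def intro: finite_subset)
    with s(2) have "p i \<le> (\<Sum>i\<in>s. p i)"
      using assms(2) by (intro member_le_sum) auto
    with s(1) assms(3) show ?thesis by force
  qed
  with assms show ?thesis by (simp add: rdp_feasible_def)
qed

text \<open>The divisor is the largest weight of a maximal independent set, so dividing by it brings
  all these weights down (or up) to at most 1.\<close>

lemma rdp_feasible_scaled:
  assumes "simple_graph V E" "\<forall>i\<in>V. 0 \<le> p i" "min_reduced_cost V E p < 1"
  shows "rdp_feasible V (max_indep_sets V E) (\<lambda>i. p i / (1 - min_reduced_cost V E p))"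
proof (rule rdp_feasible_max_indep_sets[OF assms(1)])
  show "\<forall>i\<in>V. 0 \<le> p i / (1 - min_reduced_cost V E p)"
    using assms by simp
  have "finite V"
    using assms by (simp add: simple_graph_def)
  then show "\<forall>s\<in>max_indep_sets V E. (\<Sum>i\<in>s. p i / (1 - min_reduced_cost V E p)) \<le> 1"
    using assms(3) by (simp add: sum_le_one_minus_min_reduced_cost flip: sum_divide_distrib)
qed

lemma rdp_feasible_antimono:
  "rdp_feasible V S p \<Longrightarrow> S' \<subseteq> S \<Longrightarrow> rdp_feasible V S' p"
  by (auto simp: rdp_feasible_def)

lemma grdp_feasible_imp_rdp_feasible:
  "grdp_feasible V S' y (p, wp, wm) \<Longrightarrow> rdp_feasible V S' p"
  by (simp add: grdp_feasible_def rdp_feasible_def)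

lemma dual_obj_le_rdp_optimal:
  "rdp_optimal V S' p \<Longrightarrow> rdp_feasible V S' q \<Longrightarrow> dual_obj V q \<le> dual_obj V p"
  by (auto simp: rdp_optimal_def is_arg_max_linorder)

theorem theorem3p2:
  fixes V :: "'a set" and E :: "'a set set" and S' :: "'a set set"
    and y pe wp wm p :: "'a \<Rightarrow> real" and eps_cur :: real
  assumes "simple_graph V E"
    and "S' \<subseteq> max_indep_sets V E"
    and "eps_cur \<ge> 0"
    and "grdp_optimal V S' y eps_cur (pe, wp, wm)"
    and "min_reduced_cost V E pe \<noteq> 1"
    and "rdp_optimal V S' p"
  shows "0 \<le> updated_penalty (min_reduced_cost V E pe) \<and>
         updated_penalty (min_reduced_cost V E pe) \<le> lagrangian_gap V E pe p"
proof -
  define c where "c = min_reduced_cost V E pe"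
  have feas: "rdp_feasible V S' pe"
    using assms(4) grdp_feasible_imp_rdp_feasible
    by (auto simp: grdp_optimal_def is_arg_max_linorder)
  then have nonneg: "\<forall>i\<in>V. 0 \<le> pe i"
    by (simp add: rdp_feasible_def)
  have c: "c < 1"
    unfolding c_def by (rule min_reduced_cost_less_one[OF assms(1) nonneg assms(5)])
  have le: "dual_obj V pe \<le> dual_obj V p"
    by (rule dual_obj_le_rdp_optimal[OF assms(6) feas])
  have pos: "0 < dual_obj V p"
    using dual_obj_pos[OF assms(1) nonneg assms(5)] le by linarith
  have gap: "lagrangian_gap V E pe p = 1 - dual_obj V pe / (1 - c) / dual_obj V p"
    by (simp add: lagrangian_gap_def lagrangian_bound_def c_def)
  have "0 \<le> updated_penalty c \<and> updated_penalty c \<le> lagrangian_gap V E pe p"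
  proof (cases "c < 0")
    case True
    \<comment> \<open>Exchanging the divisors isolates the ratio of the two objective values, which
      is at most 1.\<close>
    have "dual_obj V pe / (1 - c) / dual_obj V p = dual_obj V pe / dual_obj V p / (1 - c)"
      by simp
    also have "\<dots> \<le> 1 / (1 - c)"
      using le pos c by (intro divide_right_mono) simp_all
    also have "\<dots> = 1 - c / (c - 1)"
      using c by (simp add: field_simps)
    finally show ?thesis
      using True by (simp add: updated_penalty_def gap divide_nonpos_neg)
  next
    case False
    \<comment> \<open>The scaled vector satisfies the constraints of all maximal independent sets,
      in particular those in \<open>S'\<close>, so it competes with \<open>p\<close>; its objective
      value is exactly the Lagrangian bound.\<close>
    have "rdp_feasible V S' (\<lambda>i. pe i / (1 - c))"
      using rdp_feasible_antimono[OF rdp_feasible_scaled[OF assms(1) nonneg] assms(2)] c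
      by (simp add: c_def)
    from dual_obj_le_rdp_optimal[OF assms(6) this]
    have "dual_obj V pe / (1 - c) \<le> dual_obj V p"
      by (simp add: dual_obj_def sum_divide_distrib)
    with pos have "dual_obj V pe / (1 - c) / dual_obj V p \<le> 1"
      by (subst pos_divide_le_eq) simp_all
    with False show ?thesis
      by (simp add: updated_penalty_def gap)
  qed
  then show ?thesis by (simp add: c_def)
qed

end
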